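(* Let $L$ be a $4$-dimensional right Leibniz algebra over $\mathbb C$. Then $L$ is dextral symmetric if and only if $L^{(3)}=0$.
   Context: A right Leibniz algebra over a field $F$ is an $F$-vector space $L$ with a bilinear bracket $[\,,]:L\times L\to L$ satisfying $[a,[b,c]]=[[a,b],c]-[[a,c],b]$ for all $a,b,c\in L$. $L$ is dextral symmetric if for all $a,b,c\in L$, $[a,[b,c]]=0$ implies $[b,[a,c]]=0$. $L^{(1)}=L$ and $L^{(n+1)}=[L,L^{(n)}]$ (span of brackets), so $L^{(3)}=[L,[L,L]]$. *)

theory Defs
  imports Complex_Main
begin

text \<open>The underlying vector space of the algebra is the whole type \<open>'a\<close>, with an explicit
  scalar multiplication over an arbitrary field.\<close>

locale right_leibniz_algebra = vector_space scale
  for scale :: "'k::field \<Rightarrow> 'a::ab_group_add \<Rightarrow> 'a" +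
  fixes bracket :: "'a \<Rightarrow> 'a \<Rightarrow> 'a"
  assumes linear_bracket_left: "Vector_Spaces.linear scale scale (\<lambda>x. bracket x b)"
    and linear_bracket_right: "Vector_Spaces.linear scale scale (\<lambda>x. bracket a x)"
    and right_leibniz:
      "bracket a (bracket b c) = bracket (bracket a b) c - bracket (bracket a c) b"
begin

definition dextral_symmetric :: bool where
  "dextral_symmetric \<longleftrightarrow>
    (\<forall>a b c. bracket a (bracket b c) = 0 \<longrightarrow> bracket b (bracket a c) = 0)"

text \<open>The series $L^{(n)}$ starts at $n = 1$; the value at \<open>0\<close> is a dummy.\<close>

fun lower_series :: "nat \<Rightarrow> 'a set" where
  "lower_series 0 = UNIV"
| "lower_series (Suc 0) = UNIV"
| "lower_series (Suc (Suc n)) = span {bracket a x | a x. x \<in> lower_series (Suc n)}"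

end

end

theory Submission
  imports Defs
begin

text \<open>The triple product \<open>T a b c = [a, [b, c]]\<close> vanishes for \<open>b = c\<close>, so dextral
  symmetry makes it alternating in all three arguments. Modulo elements of the form
  \<open>[x, y] + [y, x]\<close>, which every left multiplication annihilates, the Leibniz identity then reads
  \<open>T = -2 T\<close>; hence \<open>[d, T a b c] = 0\<close> outside characteristic 3. If \<open>T a b c \<noteq> 0\<close>, then
  \<open>a, b, c, [b, c], T a b c\<close> are linearly independent: each is separated from the span of the later
  ones by a suitable slot of \<open>T\<close> or by the left multiplication by \<open>a\<close>. In dimension 4 this is
  impossible.\<close>

text \<open>A linear map that is zero on a set is zero on its span. Each independence claim below
  reduces to exhibiting such a separating map.\<close>

lemma (in vector_space) notin_span_if_linear_nonzero:
  assumes "Vector_Spaces.linear scale scale f" "\<And>s. s \<in> S \<Longrightarrow> f s = 0" "f x \<noteq> 0"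
  shows "x \<notin> span S"
proof
  interpret f: Vector_Spaces.linear scale scale f by fact
  assume "x \<in> span S"
  then have "f x = 0" using f.eq_0_on_span[OF assms(2)] by blast
  with assms(3) show False by contradiction
qed

context right_leibniz_algebra
begin

lemmas bracket_add_left = Vector_Spaces.linear.axioms(3)[OF linear_bracket_left, THEN module_hom.add]
lemmas bracket_add_right = Vector_Spaces.linear.axioms(3)[OF linear_bracket_right, THEN module_hom.add]

lemma bracket_minus_right: "bracket a (- x) = - bracket a x"
  using Vector_Spaces.linear.axioms(3)[OF linear_bracket_right] by (rule module_hom.neg)

lemma bracket_diff_right: "bracket a (x - y) = bracket a x - bracket a y"
  using Vector_Spaces.linear.axioms(3)[OF linear_bracket_right] by (rule module_hom.diff)

lemma bracket_zero_right: "bracket a 0 = 0"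
  using Vector_Spaces.linear.axioms(3)[OF linear_bracket_right] by (rule module_hom.zero)

lemma bracket_bracket_self: "bracket a (bracket b b) = 0"
  by (simp add: right_leibniz)

lemma bracket_bracket_swap: "bracket a (bracket c b) = - bracket a (bracket b c)"
  by (simp add: right_leibniz)

lemma linear_triple:
  "Vector_Spaces.linear scale scale (\<lambda>x. bracket x (bracket b c))"
  "Vector_Spaces.linear scale scale (\<lambda>x. bracket a (bracket x c))"
  "Vector_Spaces.linear scale scale (\<lambda>x. bracket a (bracket b x))"
  using linear_bracket_left
    Vector_Spaces.linear_compose[OF linear_bracket_left linear_bracket_right]
    Vector_Spaces.linear_compose[OF linear_bracket_right linear_bracket_right]
  by (auto simp: o_def)

lemma lower_series_3_eq_0_iff:
  "lower_series 3 = {0} \<longleftrightarrow> (\<forall>a b c. bracket a (bracket b c) = 0)"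
proof -
  let ?D = "{bracket a x | a x. x \<in> (UNIV :: 'a set)}"
  have series: "lower_series 3 = span {bracket a x | a x. x \<in> span ?D}"
    by (simp add: numeral_3_eq_3)
  show ?thesis
  proof (intro iffI allI)
    fix a b c
    assume "lower_series 3 = {0}"
    moreover have "bracket b c \<in> span ?D"
      by (rule span_base) blast
    then have "bracket a (bracket b c) \<in> lower_series 3"
      unfolding series by (intro span_base[of "bracket a (bracket b c)"]) blast
    ultimately show "bracket a (bracket b c) = 0" by simp
  next
    assume zero: "\<forall>a b c. bracket a (bracket b c) = 0"
    \<comment> \<open>The inner \<open>span\<close> contains sums of products, so the hypothesis is
      extended to them by linearity of left multiplication.\<close>
    have "bracket a x = 0" if "x \<in> span ?D" for a x
    proof (rule ccontr)
      assume "bracket a x \<noteq> 0"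
      then have "x \<notin> span ?D"
        using zero by (intro notin_span_if_linear_nonzero[OF linear_bracket_right]) auto
      with that show False by contradiction
    qed
    then have "lower_series 3 \<subseteq> span {0}"
      unfolding series by (intro span_mono) auto
    moreover have "0 \<in> lower_series 3"
      unfolding series by (rule span_zero)
    ultimately show "lower_series 3 = {0}" by auto
  qed
qed

text \<open>Dextral symmetry exchanges the first two arguments in
  \<open>bracket_bracket_self\<close>.\<close>

lemma dextral_symmetric_triple_repeat:
  assumes dextral_symmetric
  shows "bracket b (bracket a b) = 0"
  using assms bracket_bracket_self unfolding dextral_symmetric_def by blast

lemma dextral_symmetric_triple_swap:
  assumes dextral_symmetric
  shows "bracket b (bracket a c) = - bracket a (bracket b c)"
proof -
  note repeat = dextral_symmetric_triple_repeat[OF assms]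
  \<comment> \<open>Polarisation of \<open>repeat\<close> in the first and third arguments.\<close>
  have outer: "bracket x (bracket y z) = - bracket z (bracket y x)" for x y z
  proof -
    have "bracket (x + z) (bracket y (x + z)) = 0" by (rule repeat)
    then show ?thesis
      by (simp add: bracket_add_left bracket_add_right repeat eq_neg_iff_add_eq_0 add.commute)
  qed
  \<comment> \<open>The transposition (1 2) is written as (1 3)(2 3)(1 3), so three sign changes
    occur.\<close>
  have "bracket b (bracket a c) = - bracket c (bracket a b)" by (rule outer)
  also have "\<dots> = bracket c (bracket b a)" by (simp add: bracket_bracket_swap[of c b a])
  also have "\<dots> = - bracket a (bracket b c)" by (rule outer)
  finally show ?thesis .
qed

lemma dextral_symmetric_bracket_triple:
  assumes dextral_symmetric and char: "(3 :: 'k) \<noteq> 0"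
  shows "bracket d (bracket a (bracket b c)) = 0"
proof -
  let ?t = "bracket d (bracket a (bracket b c))"
  note swap = dextral_symmetric_triple_swap[OF assms(1)]
  have cycle: "bracket c (bracket a b) = bracket a (bracket b c)"
    by (simp add: swap[of c a b] bracket_bracket_swap[of a c b])
  have "?t = bracket d (bracket (bracket a b) c) - bracket d (bracket (bracket a c) b)"
    by (subst right_leibniz) (rule bracket_diff_right)
  \<comment> \<open>The bracket itself need not be antisymmetric, but it is so after left
    multiplication by \<open>d\<close>.\<close>
  also have "\<dots> = - bracket d (bracket c (bracket a b)) + bracket d (bracket b (bracket a c))"
    by (simp add: bracket_bracket_swap[of d c] bracket_bracket_swap[of d b])
  \<comment> \<open>By alternation both inner triple products are, up to sign,
    \<open>bracket a (bracket b c)\<close>.\<close>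
  also have "\<dots> = - (?t + ?t)"
    by (simp add: cycle swap[of b a c] bracket_minus_right)
  finally have "?t + (?t + ?t) = 0"
    by (simp only: eq_neg_iff_add_eq_0)
  moreover have "scale 3 ?t = ?t + (?t + ?t)"
  proof -
    have "scale 3 ?t = scale (1 + (1 + 1)) ?t" by simp
    then show ?thesis by (simp only: scale_left_distrib scale_one)
  qed
  ultimately show ?thesis using char by simp
qed

lemma dextral_symmetric_triple_eq_0:
  assumes "dextral_symmetric" "(3 :: 'k) \<noteq> 0" and dim: "dim (UNIV :: 'a set) = 4"
  shows "bracket a (bracket b c) = 0"
proof (rule ccontr)
  define u t where "u = bracket b c" and "t = bracket a u"
  assume "bracket a (bracket b c) \<noteq> 0"
  then have t: "t \<noteq> 0" by (simp add: t_def u_def)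
  note swap = dextral_symmetric_triple_swap[OF assms(1)]
  note triple = dextral_symmetric_bracket_triple[OF assms(1,2)]
  \<comment> \<open>A triple product with \<open>u\<close> or \<open>t\<close> in the last slot is
    zero; alternation carries this to the middle slot and then to the first.\<close>
  have third: "bracket x (bracket y u) = 0" "bracket x (bracket y t) = 0" for x y
    using triple bracket_zero_right by (simp_all add: u_def t_def)
  have second: "bracket x (bracket u y) = 0" "bracket x (bracket t y) = 0" for x y
    by (subst bracket_bracket_swap, simp add: third)+
  have first: "bracket u (bracket x y) = 0" "bracket t (bracket x y) = 0" for x y
    by (subst swap, simp add: second)+
  have b_bc: "bracket b (bracket b c) = 0"
    using dextral_symmetric_triple_repeat[OF assms(1)] by (subst bracket_bracket_swap) simp
  \<comment> \<open>Left multiplication by \<open>a\<close> sends \<open>u\<close> to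
    \<open>t\<close> and kills \<open>t\<close>. In the next three steps the separating map varies
    one slot of the triple product, has value \<open>t\<close> at the new vector, and kills the
    later ones because of a repeated argument or an argument \<open>u\<close> or
    \<open>t\<close>.\<close>
  have u_notin: "u \<notin> span {t}"
    using t by (intro notin_span_if_linear_nonzero[OF linear_bracket_right[of a]])
      (auto simp: t_def u_def triple)
  have c_notin: "c \<notin> span {u, t}"
    using t third by (intro notin_span_if_linear_nonzero[OF linear_triple(3)[of a b]])
      (auto simp flip: t_def u_def)
  have b_notin: "b \<notin> span {c, u, t}"
    using t second by (intro notin_span_if_linear_nonzero[OF linear_triple(2)[of a c]])
      (auto simp: bracket_bracket_self simp flip: t_def u_def)
  have a_notin: "a \<notin> span {b, c, u, t}"
    using t first[of b c, folded u_def] b_bc[folded u_def] dextral_symmetric_triple_repeat[OF assms(1), of c b, folded u_def]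
    by (intro notin_span_if_linear_nonzero[OF linear_triple(1)[of b c]])
      (auto simp flip: t_def u_def)
  have indep: "independent {a, b, c, u, t}"
    using t by (intro independent_insertI a_notin b_notin c_notin u_notin independent_empty) simp
  \<comment> \<open>Distinctness is needed, since a set display with coincidences would have fewer
    than five elements.\<close>
  have "a \<notin> {b, c, u, t}" "b \<notin> {c, u, t}" "c \<notin> {u, t}" "u \<notin> {t}"
    using a_notin b_notin c_notin u_notin by (meson span_base)+
  then have card: "card {a, b, c, u, t} = 5"
    by simp
  obtain B where B: "independent B" "UNIV \<subseteq> span B" "card B = 4"
    using basis_exists[of "UNIV :: 'a set"] dim by metis
  \<comment> \<open>An infinite set has \<open>card\<close> equal to 0, so the value 4 forces
    finiteness.\<close>
  then have "finite B" by (auto intro: card_ge_0_finite)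
  then have "card {a, b, c, u, t} \<le> card B"
    using independent_span_bound[OF _ indep] B by blast
  with card B show False by simp
qed

end

theorem theorem5p12:
  fixes scale :: "complex \<Rightarrow> 'a::ab_group_add \<Rightarrow> 'a"
    and bracket :: "'a \<Rightarrow> 'a \<Rightarrow> 'a"
  assumes "right_leibniz_algebra scale bracket"
    and "vector_space.dim scale (UNIV :: 'a set) = 4"
  shows "right_leibniz_algebra.dextral_symmetric bracket \<longleftrightarrow>
    right_leibniz_algebra.lower_series scale bracket 3 = {0}"
proof -
  interpret right_leibniz_algebra scale bracket by fact
  have "bracket a (bracket b c) = 0" if dextral_symmetric for a b c
    by (rule dextral_symmetric_triple_eq_0[OF that _ assms(2)]) simp
  then show ?thesis
    unfolding lower_series_3_eq_0_iff by (metis dextral_symmetric_def)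
qed

end
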